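(* Let $A\in\mathbb{C}^{q\times n}$, let $W\in\mathbb{C}^{n\times q}$ with $W\neq 0$, and let $m$ be a positive integer with $m>1$. Let $A^{\mathrm{wg}_j,W}$ denote the $W$-weighted $j$-weak group inverse of $A$ for a positive integer $j$. Then $$WAWA^{\mathrm{wg}_m,W}=WA^{\mathrm{wg}_{m-1},W}WA.$$
   Context: Notation: $\mathcal{R}(B)$ is the range (column space) of $B$. For square $B$, $B^0=I$ and $\mathrm{Ind}(B)$ is the smallest integer $j\ge 0$ with $\mathrm{rank}(B^{j})=\mathrm{rank}(B^{j+1})$. $P_{\mathcal{T}}$ is the orthogonal projector onto the subspace $\mathcal{T}$. $W$-product: for $X,Y\in\mathbb{C}^{q\times n}$, $X\star Y=XWY$, and $X^{\star l}=X\star\cdots\star X$ ($l$ factors) for $l\ge 1$. Weighted core-EP inverse: with $k=\max\{\mathrm{Ind}(AW),\mathrm{Ind}(WA)\}$, $A^{\mathrm{cEP},W}\in\mathbb{C}^{q\times n}$ is the unique matrix $X$ with $WAWX=P_{\mathcal{R}((WA)^k)}$ and $\mathcal{R}(X)\subseteq\mathcal{R}((AW)^k)$ (existence and uniqueness are known). $W$-weighted $j$-weak group inverse ($j\ge 1$): $A^{\mathrm{wg}_j,W}=(A^{\mathrm{cEP},W})^{\star(j+1)}\,W\,A^{\star j}$. *)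

theory Defs
  imports "HOL-Analysis.Analysis"
begin

text \<open>
  A \<open>q \<times> n\<close> complex matrix has type \<open>complex^'n^'q\<close>: the outer index type counts rows.
\<close>

text \<open>Library powers of vectors are entrywise, so \<open>^\<close> is not the matrix power.\<close>

primrec mat_pow :: "complex^'n^'n \<Rightarrow> nat \<Rightarrow> complex^'n^'n" where
  "mat_pow B 0 = mat 1"
| "mat_pow B (Suc j) = B ** mat_pow B j"

definition mat_range :: "complex^'n^'q \<Rightarrow> (complex^'q) set" where
  "mat_range B = range (\<lambda>x. B *v x)"

definition mat_index :: "complex^'n^'n \<Rightarrow> nat" where
  "mat_index B = (LEAST j. rank (mat_pow B j) = rank (mat_pow B (Suc j)))"

text \<open>The library's \<open>\<bullet>\<close> on \<open>complex^'n\<close> is only the real part of the Hermitian inner product.\<close>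

definition herm_inner :: "complex^'n \<Rightarrow> complex^'n \<Rightarrow> complex" where
  "herm_inner x y = (\<Sum>i\<in>UNIV. x $ i * cnj (y $ i))"

definition orth_projector :: "(complex^'n) set \<Rightarrow> complex^'n^'n" where
  "orth_projector T =
    (THE P. \<forall>x. P *v x \<in> T \<and> (\<forall>y\<in>T. herm_inner (x - P *v x) y = 0))"

definition w_prod ::
  "complex^'q^'n \<Rightarrow> complex^'n^'q \<Rightarrow> complex^'n^'q \<Rightarrow> complex^'n^'q" where
  "w_prod W X Y = X ** W ** Y"

text \<open>
  \<open>w_pow W X l\<close> is the \<open>W\<close>-product of \<open>l\<close> factors \<open>X\<close>, meaningful for \<open>l \<ge> 1\<close> only:
  the \<open>W\<close>-product has no unit in general, and the value at \<open>0\<close> is arbitrary.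
\<close>

fun w_pow :: "complex^'q^'n \<Rightarrow> complex^'n^'q \<Rightarrow> nat \<Rightarrow> complex^'n^'q" where
  "w_pow W X 0 = undefined"
| "w_pow W X (Suc 0) = X"
| "w_pow W X (Suc (Suc l)) = w_prod W X (w_pow W X (Suc l))"

definition weighted_core_EP :: "complex^'n^'q \<Rightarrow> complex^'q^'n \<Rightarrow> complex^'n^'q" where
  "weighted_core_EP A W =
    (let k = max (mat_index (A ** W)) (mat_index (W ** A))
     in THE X. W ** A ** W ** X = orth_projector (mat_range (mat_pow (W ** A) k))
             \<and> mat_range X \<subseteq> mat_range (mat_pow (A ** W) k))"

definition weighted_weak_group :: "nat \<Rightarrow> complex^'n^'q \<Rightarrow> complex^'q^'n \<Rightarrow> complex^'n^'q" where
  "weighted_weak_group j A W = w_pow W (weighted_core_EP A W) (j + 1) ** W ** w_pow W A j"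

end

theory Submission
  imports Defs
begin

text \<open>
  Write \<open>X\<close> for the weighted core-EP inverse of \<open>A\<close> and \<open>\<star>\<close> for the \<open>W\<close>-product. The identity is
  a cancellation: \<open>W A W X\<close> is the orthogonal projector onto the range of \<open>(W A)\<^sup>k\<close>, and \<open>W X\<close> has
  its columns in that range because those of \<open>X\<close> lie in the range of \<open>(A W)\<^sup>k\<close> and
  \<open>W (A W)\<^sup>k = (W A)\<^sup>k W\<close>. Hence \<open>W A W X W X = W X\<close>, so that multiplying a \<open>W\<close>-power of \<open>X\<close> of
  exponent at least \<open>2\<close> by \<open>W A W\<close> lowers its exponent by one and leaves a factor \<open>W\<close>. On the
  right, one factor \<open>W A\<close> is split off the \<open>W\<close>-power of \<open>A\<close>; this is where \<open>m > 1\<close> enters.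

  The two properties of \<open>X\<close> are available only once the definite description defining it is known
  to denote, so most of the work is existence and uniqueness of \<open>X\<close>. Both rest on the
  stabilisation of powers: for \<open>k\<close> at least the index of \<open>B\<close>, the matrix \<open>B\<close> maps the range of
  \<open>B\<^sup>k\<close> bijectively onto itself (\<open>mat_pow_kernel_stable\<close>, \<open>mat_pow_range_stable\<close>). Surjectivity for
  \<open>B = W A\<close> lets one write the projector as \<open>(W A)\<^sup>k\<^sup>+\<^sup>2 Z = W A W ((A W)\<^sup>k A Z)\<close>, which exhibits
  a solution; injectivity for \<open>B = A W\<close> makes \<open>W A W\<close> injective on the range of \<open>(A W)\<^sup>k\<close>, which
  gives uniqueness.
\<close>

section \<open>Ranges, kernels and ranks\<close>

lemma mat_range_subspace: "vec.subspace (mat_range M)"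
  unfolding mat_range_def
  using vec.linear_subspace_image[OF matrix_vector_mul_linear_gen vec.subspace_UNIV] .

lemma mat_range_mult_subset: "mat_range (M ** N) \<subseteq> mat_range M"
  unfolding mat_range_def by (auto simp flip: matrix_vector_mul_assoc)

lemma mat_range_subset_imp_factor:
  fixes P :: "complex^'n^'q" and M :: "complex^'r^'q"
  assumes "mat_range P \<subseteq> mat_range M"
  obtains Z where "P = M ** Z"
proof -
  have "\<exists>z. P *v axis j 1 = M *v z" for j
    using assms unfolding mat_range_def by blast
  then obtain z where z: "\<And>j. P *v axis j 1 = M *v z j" by metis
  define Z :: "complex^'n^'r" where "Z = (\<chi> i j. z j $ i)"
  have "column j P = column j (M ** Z)" for j
    using z[of j]
    by (simp add: vec_eq_iff column_def Z_def matrix_matrix_mult_def matrix_vector_mult_def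
        axis_def if_distrib cong: if_cong)
  then have "P = M ** Z"
    by (simp add: vec_eq_iff column_def)
  then show ?thesis by (rule that)
qed

lemma rows_mult_subset_span:
  fixes Z :: "'a::field^'n^'m" and B :: "'a^'p^'n"
  shows "rows (Z ** B) \<subseteq> vec.span (rows B)"
proof -
  have "row i (Z ** B) = (\<Sum>k\<in>UNIV. Z $ i $ k *s row k B)" for i
    by (simp add: vec_eq_iff row_def matrix_matrix_mult_def)
  moreover have "(\<Sum>k\<in>UNIV. Z $ i $ k *s row k B) \<in> vec.span (rows B)" for i
    by (intro vec.span_sum vec.span_scale vec.span_base) (auto simp: rows_def)
  ultimately show ?thesis by (auto simp: rows_def)
qed

lemma rank_mult_le:
  fixes Z :: "'a::field^'n^'m" and B :: "'a^'p^'n"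
  shows "rank (Z ** B) \<le> rank B"
  unfolding row_rank_def_gen by (rule vec.dim_mono[OF rows_mult_subset_span])

text \<open>
  Since the rank is the dimension of the row space, equality of ranks makes the row spaces of
  \<open>Z B\<close> and \<open>B\<close> coincide, and the kernel of a matrix is the set of vectors annihilated by its row
  space.
\<close>

lemma kernel_mult_eq_if_rank_eq:
  fixes Z :: "'a::field^'n^'m" and B :: "'a^'p^'n"
  assumes "rank (Z ** B) = rank B" and "(Z ** B) *v x = 0"
  shows "B *v x = 0"
proof -
  have "vec.span (rows (Z ** B)) = vec.span (rows B)"
  proof (rule vec.subspace_dim_equal)
    show "vec.span (rows (Z ** B)) \<subseteq> vec.span (rows B)"
      using rows_mult_subset_span by (metis vec.span_mono vec.span_span)
    show "vec.dim (vec.span (rows B)) \<le> vec.dim (vec.span (rows (Z ** B)))"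
      using assms(1) by (simp add: row_rank_def_gen)
  qed simp_all
  moreover have "vec.span (rows (Z ** B)) \<subseteq> {v. (\<Sum>i\<in>UNIV. v $ i * x $ i) = 0}"
  proof (rule vec.span_minimal)
    show "rows (Z ** B) \<subseteq> {v. (\<Sum>i\<in>UNIV. v $ i * x $ i) = 0}"
      using assms(2) by (auto simp: rows_def row_def matrix_vector_mult_def vec_eq_iff)
    show "vec.subspace {v. (\<Sum>i\<in>UNIV. v $ i * x $ i) = 0}"
      by (auto simp: vec.subspace_def distrib_right sum.distrib mult.assoc
          simp flip: sum_distrib_left)
  qed
  ultimately have "row i B \<in> {v. (\<Sum>i\<in>UNIV. v $ i * x $ i) = 0}" for i
    using vec.span_base[of "row i B" "rows B"] by (auto simp: rows_def)
  then show ?thesis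
    by (simp add: vec_eq_iff row_def matrix_vector_mult_def)
qed

section \<open>Powers beyond the index\<close>

lemma mat_pow_add: "mat_pow B (i + j) = mat_pow B i ** mat_pow B j"
  by (induction i) (simp_all add: matrix_mul_assoc)

lemma mat_pow_Suc_right: "mat_pow B (Suc j) = mat_pow B j ** B"
  using mat_pow_add[of B j 1] by simp

lemma mat_pow_mult_swap: "M ** mat_pow (N ** M) j = mat_pow (M ** N) j ** M"
proof (induction j)
  case (Suc j)
  have "M ** mat_pow (N ** M) (Suc j) = M ** N ** (M ** mat_pow (N ** M) j)"
    by (simp add: matrix_mul_assoc)
  also have "\<dots> = mat_pow (M ** N) (Suc j) ** M"
    by (simp add: Suc matrix_mul_assoc)
  finally show ?case .
qed simp

text \<open>
  Ranks of successive powers are non-increasing natural numbers, so they cannot drop forever; hence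
  the minimum defining the index is attained.
\<close>

lemma rank_mat_pow_index:
  "rank (mat_pow B (mat_index B)) = rank (mat_pow B (Suc (mat_index B)))"
proof -
  have "\<exists>j. rank (mat_pow B j) = rank (mat_pow B (Suc j))"
  proof (rule ccontr)
    assume never: "\<nexists>j. rank (mat_pow B j) = rank (mat_pow B (Suc j))"
    have drop: "rank (mat_pow B (Suc j)) < rank (mat_pow B j)" for j
      using never rank_mult_le[of B "mat_pow B j"] by (metis le_neq_implies_less mat_pow.simps(2))
    have "rank (mat_pow B j) + j \<le> rank (mat_pow B 0)" for j
    proof (induction j)
      case (Suc j)
      then show ?case using drop[of j] by linarith
    qed simp
    from this[of "Suc (rank (mat_pow B 0))"] show False by simp
  qed
  then show ?thesis unfolding mat_index_def by (rule LeastI_ex)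
qed

lemma mat_pow_kernel_stable:
  assumes "mat_index B \<le> k" and "mat_pow B (Suc k) *v x = 0"
  shows "mat_pow B k *v x = 0"
proof -
  define j d where "j = mat_index B" and "d = k - mat_index B"
  have k: "k = j + d" using assms(1) by (simp add: j_def d_def)
  have "mat_pow B (Suc k) = B ** mat_pow B j ** mat_pow B d"
    by (simp add: k mat_pow_add matrix_mul_assoc)
  then have "(B ** mat_pow B j) *v (mat_pow B d *v x) = 0"
    using assms(2) by (simp add: matrix_vector_mul_assoc)
  moreover have "rank (B ** mat_pow B j) = rank (mat_pow B j)"
    using rank_mat_pow_index[of B] by (simp add: j_def)
  ultimately have "mat_pow B j *v (mat_pow B d *v x) = 0"
    by (rule kernel_mult_eq_if_rank_eq[rotated])
  then show ?thesis by (simp add: k mat_pow_add matrix_vector_mul_assoc)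
qed

text \<open>
  Kernel stability says that \<open>B\<close> is injective on the range of its \<open>k\<close>-th power; being a
  finite-dimensional space that \<open>B\<close> maps into itself, this range is then also mapped onto itself.
\<close>

lemma mat_pow_range_stable:
  assumes "mat_index B \<le> k"
  shows "mat_range (mat_pow B (Suc k)) = mat_range (mat_pow B k)"
proof (rule vec.subspace_dim_equal)
  let ?R = "mat_range (mat_pow B k)"
  have image: "(*v) B ` ?R = mat_range (mat_pow B (Suc k))"
    by (simp add: mat_range_def image_image matrix_vector_mul_assoc)
  have "inj_on ((*v) B) (vec.span ?R)"
  proof -
    have "u = v" if u: "u \<in> ?R" and v: "v \<in> ?R" and eq: "B *v u = B *v v" for u v
    proof -
      obtain x where x: "u - v = mat_pow B k *v x"
        using vec.subspace_diff[OF mat_range_subspace u v] by (auto simp: mat_range_def)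
      have "mat_pow B (Suc k) *v x = B *v (u - v)"
        by (simp add: x matrix_vector_mul_assoc)
      also have "\<dots> = 0" using eq by (simp add: matrix_vector_mult_diff_distrib)
      finally have "u - v = 0" using mat_pow_kernel_stable[OF assms] x by simp
      then show ?thesis by simp
    qed
    moreover have "vec.span ?R = ?R"
      by (simp add: vec.span_eq_iff mat_range_subspace)
    ultimately show ?thesis by (metis inj_onI)
  qed
  then have "vec.dim ((*v) B ` ?R) = vec.dim ?R"
    by (intro vec.dim_image_eq) simp_all
  then show "vec.dim ?R \<le> vec.dim (mat_range (mat_pow B (Suc k)))"
    by (simp add: image)
  show "mat_range (mat_pow B (Suc k)) \<subseteq> ?R"
    unfolding mat_pow_Suc_right by (rule mat_range_mult_subset)
qed (rule mat_range_subspace)+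

section \<open>The orthogonal projector\<close>

lemma herm_inner_add_left: "herm_inner (x + y) z = herm_inner x z + herm_inner y z"
  by (simp add: herm_inner_def distrib_right sum.distrib)

lemma herm_inner_diff_left: "herm_inner (x - y) z = herm_inner x z - herm_inner y z"
  by (simp add: herm_inner_def left_diff_distrib sum_subtractf)

lemma herm_inner_sum_scale_left:
  "herm_inner (\<Sum>i\<in>I. c i *s f i) z = (\<Sum>i\<in>I. c i * herm_inner (f i) z)"
  unfolding herm_inner_def
  by (simp add: sum_distrib_right sum_distrib_left mult.assoc) (rule sum.swap)

lemma inner_eq_Re_herm_inner: "x \<bullet> y = Re (herm_inner x y)"
  by (simp add: herm_inner_def inner_vec_def inner_complex_def)

lemma herm_inner_self_eq_0D: "herm_inner x x = 0 \<Longrightarrow> x = 0"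
  by (metis inner_eq_Re_herm_inner inner_eq_zero_iff zero_complex.simps(1))

lemma herm_inner_scale_right: "herm_inner x (c *s y) = cnj c * herm_inner x y"
  by (simp add: herm_inner_def sum_distrib_left mult_ac)

text \<open>
  A complex subspace is closed under multiplication by \<open>\<i>\<close>, so orthogonality to it for the real
  inner product already forces the imaginary part of the Hermitian inner product to vanish. This
  gives the Hermitian decomposition from the one in real Euclidean space.
\<close>

lemma herm_orthogonal_decomposition:
  fixes T :: "(complex^'n) set"
  assumes "vec.subspace T"
  shows "\<exists>p\<in>T. \<forall>w\<in>T. herm_inner (x - p) w = 0"
proof -
  have "c *\<^sub>R v = complex_of_real c *s v" for c and v :: "complex^'n"
    unfolding vec_eq_iff vector_scaleR_component vector_smult_component
    by (simp add: scaleR_conv_of_real)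
  then have "subspace T"
    using assms by (auto simp: vec.subspace_def subspace_def)
  then have span: "span T = T" by (simp add: span_eq_iff)
  obtain p z where pz: "p \<in> span T" "\<And>w. w \<in> span T \<Longrightarrow> orthogonal z w" "x = p + z"
    using orthogonal_subspace_decomp_exists[of T x] by blast
  have "herm_inner z w = 0" if "w \<in> T" for w
  proof (rule complex_eqI)
    have "\<i> *s w \<in> T" using assms that by (simp add: vec.subspace_scale)
    then have "Re (herm_inner z (\<i> *s w)) = 0" and "Re (herm_inner z w) = 0"
      using pz(2) that span by (auto simp: orthogonal_def inner_eq_Re_herm_inner)
    then show "Re (herm_inner z w) = Re 0" and "Im (herm_inner z w) = Im 0"
      by (simp_all add: herm_inner_scale_right)
  qed
  then show ?thesis using pz span by (intro bexI[of _ p]) auto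
qed

lemma orth_projector_props:
  fixes T :: "(complex^'n) set"
  assumes T: "vec.subspace T"
  shows orth_projector_in: "orth_projector T *v x \<in> T"
    and orth_projector_orthogonal: "\<And>y. y \<in> T \<Longrightarrow> herm_inner (x - orth_projector T *v x) y = 0"
proof -
  let ?is_proj = "\<lambda>P. \<forall>x. P *v x \<in> T \<and> (\<forall>y\<in>T. herm_inner (x - P *v x) y = 0)"
  obtain p where p: "\<And>x. p x \<in> T" "\<And>x y. y \<in> T \<Longrightarrow> herm_inner (x - p x) y = 0"
    using herm_orthogonal_decomposition[OF T] by metis
  \<comment> \<open>The conditions on \<open>P\<close> extend linearly from the standard basis, whose images are prescribed.\<close>
  define P :: "complex^'n^'n" where "P = (\<chi> i j. p (axis j 1) $ i)"
  have P: "P *v x = (\<Sum>j\<in>UNIV. x $ j *s p (axis j 1))" for x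
    by (simp add: vec_eq_iff P_def matrix_vector_mult_def mult.commute)
  have "?is_proj P"
  proof (intro allI conjI ballI)
    fix x
    show "P *v x \<in> T"
      unfolding P by (intro vec.subspace_sum vec.subspace_scale T p)
    fix y assume y: "y \<in> T"
    have "x - P *v x = (\<Sum>j\<in>UNIV. x $ j *s axis j 1) - (\<Sum>j\<in>UNIV. x $ j *s p (axis j 1))"
      by (simp add: P basis_expansion)
    also have "\<dots> = (\<Sum>j\<in>UNIV. x $ j *s (axis j 1 - p (axis j 1)))"
      by (simp add: vec.scale_right_diff_distrib sum_subtractf)
    finally show "herm_inner (x - P *v x) y = 0"
      by (simp only: herm_inner_sum_scale_left p(2)[OF y] mult_zero_right sum.neutral_const)
  qed
  moreover have "Q = P" if "?is_proj Q" for Q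
  proof -
    have "Q *v x = P *v x" for x
    proof -
      have d: "Q *v x - P *v x \<in> T"
        using that \<open>?is_proj P\<close> T by (simp add: vec.subspace_diff)
      have "Q *v x - P *v x = (x - P *v x) - (x - Q *v x)" by simp
      then have "herm_inner (Q *v x - P *v x) (Q *v x - P *v x) = 0"
        using that \<open>?is_proj P\<close> d by (metis herm_inner_diff_left diff_self)
      then show ?thesis using herm_inner_self_eq_0D by fastforce
    qed
    then show ?thesis by (simp add: matrix_eq)
  qed
  ultimately have "?is_proj (orth_projector T)"
    unfolding orth_projector_def by (rule theI)
  then show "orth_projector T *v x \<in> T"
    and "\<And>y. y \<in> T \<Longrightarrow> herm_inner (x - orth_projector T *v x) y = 0"
    by blast+
qed

lemma orth_projector_fixes:
  assumes T: "vec.subspace T" and x: "x \<in> T"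
  shows "orth_projector T *v x = x"
proof -
  have "x - orth_projector T *v x \<in> T"
    using T x by (simp add: vec.subspace_diff orth_projector_in)
  then have "x - orth_projector T *v x = 0"
    using orth_projector_orthogonal[OF T] herm_inner_self_eq_0D by blast
  then show ?thesis by simp
qed

lemma orth_projector_mult_eq:
  assumes "vec.subspace T" and "mat_range M \<subseteq> T"
  shows "orth_projector T ** M = M"
proof -
  have "(orth_projector T ** M) *v x = M *v x" for x
    using assms orth_projector_fixes[of T "M *v x"]
    by (auto simp: mat_range_def simp flip: matrix_vector_mul_assoc)
  then show ?thesis by (simp add: matrix_eq)
qed

section \<open>The weighted core-EP inverse\<close>

lemma weighted_core_EP_exists:
  fixes A :: "complex^'n^'q" and W :: "complex^'q^'n"
  assumes "mat_index (W ** A) \<le> k"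
  shows "\<exists>X. W ** A ** W ** X = orth_projector (mat_range (mat_pow (W ** A) k))
             \<and> mat_range X \<subseteq> mat_range (mat_pow (A ** W) k)"
proof -
  let ?C = "W ** A"
  have "mat_range (mat_pow ?C (Suc (Suc k))) = mat_range (mat_pow ?C k)"
    using mat_pow_range_stable[of ?C k] mat_pow_range_stable[of ?C "Suc k"] assms by simp
  moreover have "mat_range (orth_projector (mat_range (mat_pow ?C k))) \<subseteq> mat_range (mat_pow ?C k)"
    using orth_projector_in[OF mat_range_subspace]
    unfolding mat_range_def[of "orth_projector _"] by blast
  ultimately obtain Z where
    Z: "orth_projector (mat_range (mat_pow ?C k)) = mat_pow ?C (Suc (Suc k)) ** Z"
    using mat_range_subset_imp_factor by metis
  have "mat_pow ?C (Suc (Suc k)) = W ** A ** W ** (A ** mat_pow ?C k)"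
    by (simp add: matrix_mul_assoc)
  also have "\<dots> = W ** A ** W ** (mat_pow (A ** W) k ** A)"
    by (simp only: mat_pow_mult_swap)
  finally have "W ** A ** W ** (mat_pow (A ** W) k ** (A ** Z))
      = orth_projector (mat_range (mat_pow ?C k))"
    by (simp add: Z matrix_mul_assoc)
  then show ?thesis using mat_range_mult_subset by blast
qed

text \<open>
  A difference \<open>d = (A W)\<^sup>k x\<close> annihilated by \<open>W A W\<close> is annihilated by \<open>(A W)\<^sup>2\<close>, so \<open>x\<close> lies in the
  kernel of \<open>(A W)\<^sup>k\<^sup>+\<^sup>2\<close>, which is that of \<open>(A W)\<^sup>k\<close>.
\<close>

lemma weighted_core_EP_unique:
  fixes A :: "complex^'n^'q" and W :: "complex^'q^'n"
  assumes k: "mat_index (A ** W) \<le> k"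
    and eq: "W ** A ** W ** X = W ** A ** W ** Y"
    and X: "mat_range X \<subseteq> mat_range (mat_pow (A ** W) k)"
    and Y: "mat_range Y \<subseteq> mat_range (mat_pow (A ** W) k)"
  shows "X = Y"
proof -
  let ?B = "A ** W"
  have "X *v v = Y *v v" for v
  proof -
    have "X *v v \<in> mat_range (mat_pow ?B k)" "Y *v v \<in> mat_range (mat_pow ?B k)"
      using X Y by (auto simp: mat_range_def)
    then obtain x where x: "X *v v - Y *v v = mat_pow ?B k *v x"
      using vec.subspace_diff[OF mat_range_subspace] unfolding mat_range_def by blast
    have "mat_pow ?B (Suc (Suc k)) *v x = A *v ((W ** A ** W) *v (mat_pow ?B k *v x))"
      by (simp add: matrix_vector_mul_assoc matrix_mul_assoc)
    also have "\<dots> = A *v ((W ** A ** W ** X) *v v - (W ** A ** W ** Y) *v v)"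
      by (simp add: matrix_vector_mult_diff_distrib matrix_vector_mul_assoc flip: x)
    also have "\<dots> = 0" by (simp add: eq)
    finally have "mat_pow ?B k *v x = 0"
      using mat_pow_kernel_stable[of ?B "Suc k" x] mat_pow_kernel_stable[OF k, of x] k by simp
    then show ?thesis using x by simp
  qed
  then show ?thesis by (simp add: matrix_eq)
qed

lemma weighted_core_EP_props:
  fixes A :: "complex^'n^'q" and W :: "complex^'q^'n"
  defines "k \<equiv> max (mat_index (A ** W)) (mat_index (W ** A))"
  shows weighted_core_EP_projector:
      "W ** A ** W ** weighted_core_EP A W = orth_projector (mat_range (mat_pow (W ** A) k))"
    and weighted_core_EP_range:
      "mat_range (weighted_core_EP A W) \<subseteq> mat_range (mat_pow (A ** W) k)"
proof -
  let ?spec = "\<lambda>X. W ** A ** W ** X = orth_projector (mat_range (mat_pow (W ** A) k))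
             \<and> mat_range X \<subseteq> mat_range (mat_pow (A ** W) k)"
  have "mat_index (A ** W) \<le> k" "mat_index (W ** A) \<le> k" by (simp_all add: k_def)
  then have "\<exists>!X. ?spec X"
    by (intro ex_ex1I weighted_core_EP_exists weighted_core_EP_unique[of A W k]) auto
  moreover have "weighted_core_EP A W = (THE X. ?spec X)"
    by (simp add: weighted_core_EP_def k_def Let_def)
  ultimately have "?spec (weighted_core_EP A W)" by (metis (mono_tags, lifting) theI')
  then show "W ** A ** W ** weighted_core_EP A W
      = orth_projector (mat_range (mat_pow (W ** A) k))"
    and "mat_range (weighted_core_EP A W) \<subseteq> mat_range (mat_pow (A ** W) k)" by blast+
qed

text \<open>
  Intertwining \<open>W (A W)\<^sup>k = (W A)\<^sup>k W\<close> carries the range condition on \<open>X\<close> to \<open>W X\<close>, which the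
  projector \<open>W A W X\<close> therefore fixes.
\<close>

lemma weighted_core_EP_cancel:
  "W ** A ** W ** weighted_core_EP A W ** W ** weighted_core_EP A W = W ** weighted_core_EP A W"
proof -
  define k where "k = max (mat_index (A ** W)) (mat_index (W ** A))"
  let ?X = "weighted_core_EP A W" and ?T = "mat_range (mat_pow (W ** A) k)"
  obtain Z where "?X = mat_pow (A ** W) k ** Z"
    using mat_range_subset_imp_factor weighted_core_EP_range unfolding k_def by metis
  then have "W ** ?X = W ** mat_pow (A ** W) k ** Z" by (simp add: matrix_mul_assoc)
  also have "\<dots> = mat_pow (W ** A) k ** (W ** Z)"
    by (simp add: mat_pow_mult_swap matrix_mul_assoc)
  finally have "mat_range (W ** ?X) \<subseteq> ?T" by (simp add: mat_range_mult_subset)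
  then have "orth_projector ?T ** (W ** ?X) = W ** ?X"
    by (rule orth_projector_mult_eq[OF mat_range_subspace])
  then show ?thesis
    by (simp add: k_def matrix_mul_assoc flip: weighted_core_EP_projector)
qed

section \<open>Weighted weak group inverses\<close>

lemma w_pow_Suc: "l \<ge> 1 \<Longrightarrow> w_pow W X (Suc l) = X ** W ** w_pow W X l"
  by (cases l) (simp_all add: w_prod_def)

lemma w_pow_Suc_right: "l \<ge> 1 \<Longrightarrow> w_pow W X (Suc l) = w_pow W X l ** W ** X"
  by (induction l rule: nat_induct_at_least) (simp_all add: w_pow_Suc w_prod_def matrix_mul_assoc)

lemma w_pow_weighted_core_EP_cancel:
  assumes "l \<ge> 1"
  shows "W ** A ** W ** w_pow W (weighted_core_EP A W) (Suc l)
       = W ** w_pow W (weighted_core_EP A W) l"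
proof (cases "l = 1")
  case True
  then show ?thesis
    using weighted_core_EP_cancel[of W A] by (simp add: w_prod_def matrix_mul_assoc)
next
  case False
  then obtain j where j: "l = Suc j" "j \<ge> 1" using assms by (cases l) auto
  then show ?thesis
    using weighted_core_EP_cancel[of W A] by (simp add: w_pow_Suc w_prod_def matrix_mul_assoc)
qed

theorem theorem3p2:
  fixes A :: "complex^'n^'q" and W :: "complex^'q^'n" and m :: nat
  assumes "W \<noteq> 0" and "m > 1"
  shows "W ** A ** W ** weighted_weak_group m A W
       = W ** weighted_weak_group (m - 1) A W ** W ** A"
proof -
  let ?X = "weighted_core_EP A W"
  obtain l where m: "m = Suc l" and l: "l \<ge> 1" using assms(2) by (cases m) auto
  have "W ** A ** W ** weighted_weak_group m A W
      = W ** A ** W ** w_pow W ?X (Suc m) ** W ** w_pow W A m"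
    by (simp add: weighted_weak_group_def matrix_mul_assoc)
  also have "\<dots> = W ** w_pow W ?X m ** W ** w_pow W A m"
    using assms(2) by (simp add: w_pow_weighted_core_EP_cancel del: w_pow.simps)
  also have "\<dots> = W ** w_pow W ?X m ** W ** w_pow W A l ** W ** A"
    using l by (simp add: m w_pow_Suc_right[of l W A] matrix_mul_assoc del: w_pow.simps)
  also have "\<dots> = W ** weighted_weak_group (m - 1) A W ** W ** A"
    by (simp add: weighted_weak_group_def m matrix_mul_assoc del: w_pow.simps)
  finally show ?thesis .
qed

end
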